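(* For every non-negative integer $m$, the following three identities hold: $$\sum_{n=0}^{m}\frac{\binom{2n}{n}\binom{4n}{2n}}{64^n}=\frac{(4m+1)(4m+3)}{64^m}\binom{2m}{m}\binom{4m}{2m}\sum_{j=0}^{m}(-1)^j\binom{m}{j}\frac{64^j}{(4j+1)(4j+3)\binom{2j}{j}\binom{4j}{2j}},$$ $$\sum_{n=0}^{m}\frac{\binom{2n}{n}\binom{4n}{2n}}{64^n}H_n=\frac{(4m+1)(4m+3)}{64^m}\binom{2m}{m}\binom{4m}{2m}\sum_{j=0}^{m}(-1)^j\binom{m}{j}\frac{64^j(H_m+H_j)}{(4j+1)(4j+3)\binom{2j}{j}\binom{4j}{2j}},$$ $$\sum_{n=0}^{m}\frac{\binom{2n}{n}\binom{4n}{2n}}{64^n}\left(H_n^2+H_n^{(2)}\right)=\frac{(4m+1)(4m+3)}{64^m}\binom{2m}{m}\binom{4m}{2m}\sum_{j=0}^{m}(-1)^j\binom{m}{j}\frac{64^j\left((H_m+H_j)^2+H_m^{(2)}-H_j^{(2)}\right)}{(4j+1)(4j+3)\binom{2j}{j}\binom{4j}{2j}}.$$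
   Context: $H_n^{(s)}=\sum_{k=1}^n k^{-s}$ (with $H_0^{(s)}=0$) and $H_n=H_n^{(1)}$. *)

theory Defs
  imports "HOL-Analysis.Analysis"
begin

definition gen_harm :: "nat \<Rightarrow> nat \<Rightarrow> real" where
  "gen_harm s n = (\<Sum>k=1..n. 1 / real k ^ s)"

text \<open>The ordinary harmonic number \<open>H\<^sub>n = H\<^sub>n\<^sup>(\<^sup>1\<^sup>)\<close> is the library's \<^const>\<open>harm\<close>.\<close>

lemma gen_harm_1: "gen_harm 1 n = harm n"
  by (simp add: gen_harm_def harm_def inverse_eq_divide)

end

theory Submission
  imports Defs
begin

text \<open>
  Since \<open>binom(2n,n) binom(4n,2n) / 64\<^sup>n = (a)\<^sub>n (b)\<^sub>n / n!\<^sup>2\<close> with \<open>a = 1/4\<close>, \<open>b = 3/4\<close>,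
  the three identities are the coefficients of \<open>1\<close>, \<open>x\<close> and \<open>x\<^sup>2\<close> (the last one doubled) of a
  single identity with a free parameter \<open>x\<close>, valid whenever \<open>a + b = 1\<close>:
  \[ \sum_{n=0}^{m} \frac{(a)_n (b)_n}{n!\,(1-x)_n}
     = \frac{(a)_{m+1} (b)_{m+1}}{m!\,(1-x)_m}
       \sum_{j=0}^{m} (-1)^j \binom{m}{j} \frac{j!\,(1+x)_j}{(a)_{j+1} (b)_{j+1}} . \]
  Indeed \<open>n!/(1-x)\<^sub>n\<close> generates the complete symmetric functions of \<open>1, 1/2, ..., 1/n\<close>, that is
  \<open>1\<close>, \<open>H\<^sub>n\<close>, \<open>(H\<^sub>n\<^sup>2 + H\<^sub>n\<^sup>(\<^sup>2\<^sup>))/2\<close>, and \<open>(1+x)\<^sub>j/j!\<close> generates the elementary ones,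
  \<open>1\<close>, \<open>H\<^sub>j\<close>, \<open>(H\<^sub>j\<^sup>2 - H\<^sub>j\<^sup>(\<^sup>2\<^sup>))/2\<close>; the product of the two gives the weights on the right.

  The identity with the parameter follows by induction on \<open>m\<close>. If \<open>T\<^sub>m\<close> is the alternating sum on
  the right, the induction step amounts to
  \<open>(m+1+a) (m+1+b) T\<^bsub>m+1\<^esub> - (m+1) (m+1-x) T\<^sub>m = 1\<close>. By \<open>a + b = 1\<close> the combined summand is the
  difference of consecutive values of
  \<open>- (-1)\<^sup>j binom(m+1,j) (j+a) (j+b) C\<^sub>j\<close>, where \<open>C\<^sub>j = j! (1+x)\<^sub>j / ((a)\<^bsub>j+1\<^esub> (b)\<^bsub>j+1\<^esub>)\<close>, so the sum
  telescopes to its boundary term \<open>a b C\<^sub>0 = 1\<close>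
  (\<open>alternating_sum_recurrence\<close>, \<open>partial_sum_eq_alternating_sum\<close>). Neither step divides, so both
  hold in any commutative ring; taking formal power series, with \<open>x\<close> the indeterminate, makes the
  comparison of coefficients immediate.
\<close>

unbundle no vec_syntax and fps_syntax

section \<open>The identity with a parameter\<close>

text \<open>
  The certificate \<open>G\<close> below is the telescoping function; multiplying \<open>binom(m,j)\<close> by \<open>m + 1\<close> turns
  it into \<open>(m+1-j) binom(m+1,j)\<close>, so that both alternating sums share one binomial coefficient.
\<close>

lemma alternating_sum_recurrence:
  fixes a b x :: "'a::comm_ring_1" and C :: "nat \<Rightarrow> 'a"
  assumes ab: "a + b = 1"
    and C0: "a * b * C 0 = 1"
    and CSuc: "\<And>j. (of_nat (Suc j) + a) * (of_nat (Suc j) + b) * C (Suc j)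
                    = of_nat (Suc j) * (of_nat (Suc j) + x) * C j"
  shows "(of_nat (Suc m) + a) * (of_nat (Suc m) + b)
           * (\<Sum>j\<le>Suc m. (-1) ^ j * of_nat (Suc m choose j) * C j)
         = 1 + of_nat (Suc m) * (of_nat (Suc m) - x)
               * (\<Sum>j\<le>m. (-1) ^ j * of_nat (m choose j) * C j)"
proof -
  define M :: 'a where "M = of_nat (Suc m)"
  define B :: "nat \<Rightarrow> 'a" where "B j = of_nat (Suc m choose j)" for j
  define G where "G j = - ((-1) ^ j * B j * ((of_nat j + a) * (of_nat j + b) * C j))" for j
  have b: "b = 1 - a"
    using ab by (simp add: algebra_simps)
  have absorb: "M * of_nat (m choose j) = (M - of_nat j) * B j" if "j \<le> Suc m" for j
  proof -
    have "Suc m * (m choose j) = (Suc m - j) * (Suc m choose j)"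
      using binomial_absorb_comp[of "Suc m" j] by simp
    hence "of_nat (Suc m) * of_nat (m choose j) = (of_nat (Suc m - j) * of_nat (Suc m choose j) :: 'a)"
      by (metis of_nat_mult)
    thus ?thesis
      using that by (simp only: M_def B_def of_nat_diff)
  qed
  have shift: "of_nat (Suc j) * B (Suc j) = (M - of_nat j) * B j" if "j \<le> Suc m" for j
  proof -
    have "of_nat (Suc j) * B (Suc j) = M * of_nat (m choose j)"
      unfolding B_def M_def by (metis Suc_times_binomial_eq of_nat_mult mult.commute)
    thus ?thesis
      using absorb[OF that] by simp
  qed
  have step: "(M + a) * (M + b) * ((-1) ^ j * B j * C j)
                - M * (M - x) * ((-1) ^ j * of_nat (m choose j) * C j)
              = G (Suc j) - G j" if "j \<le> Suc m" for j
  proof -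
    have "G (Suc j) = (-1) ^ j * B (Suc j) * (of_nat (Suc j) * (of_nat (Suc j) + x) * C j)"
      unfolding G_def CSuc by simp
    also have "\<dots> = (-1) ^ j * (of_nat (Suc j) * B (Suc j)) * ((of_nat (Suc j) + x) * C j)"
      by (simp only: mult_ac)
    also have "\<dots> = (-1) ^ j * ((M - of_nat j) * B j) * ((of_nat j + 1 + x) * C j)"
      by (simp only: shift[OF that]) (simp add: add_ac)
    finally have G: "G (Suc j) = \<dots>" .
    have "M * (M - x) * ((-1) ^ j * of_nat (m choose j) * C j)
          = (M - x) * ((-1) ^ j * (M * of_nat (m choose j)) * C j)"
      by (simp only: mult_ac)
    also have "\<dots> = (M - x) * ((-1) ^ j * ((M - of_nat j) * B j) * C j)"
      by (simp only: absorb[OF that])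
    finally have L: "M * (M - x) * ((-1) ^ j * of_nat (m choose j) * C j) = \<dots>" .
    show ?thesis
      unfolding L G unfolding G_def b by (simp add: algebra_simps)
  qed
  have "(M + a) * (M + b) * (\<Sum>j\<le>Suc m. (-1) ^ j * B j * C j)
          - M * (M - x) * (\<Sum>j\<le>Suc m. (-1) ^ j * of_nat (m choose j) * C j)
        = (\<Sum>j\<le>Suc m. (M + a) * (M + b) * ((-1) ^ j * B j * C j)
            - M * (M - x) * ((-1) ^ j * of_nat (m choose j) * C j))"
    by (simp only: sum_subtractf sum_distrib_left)
  also have "\<dots> = (\<Sum>j<Suc (Suc m). G (Suc j) - G j)"
    by (rule sum.cong) (use step in \<open>auto simp: lessThan_Suc_atMost\<close>)
  also have "\<dots> = G (Suc (Suc m)) - G 0"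
    by (rule sum_lessThan_telescope)
  also have "\<dots> = 1"
    using C0 by (simp add: G_def B_def binomial_eq_0 del: binomial_Suc_Suc)
  finally have "(M + a) * (M + b) * (\<Sum>j\<le>Suc m. (-1) ^ j * B j * C j)
                = 1 + M * (M - x) * (\<Sum>j\<le>Suc m. (-1) ^ j * of_nat (m choose j) * C j)"
    by (simp add: algebra_simps)
  moreover have "(\<Sum>j\<le>Suc m. (-1) ^ j * of_nat (m choose j) * C j)
                 = (\<Sum>j\<le>m. (-1) ^ j * of_nat (m choose j) * C j)"
    by (simp add: binomial_eq_0)
  ultimately show ?thesis
    by (simp only: M_def B_def)
qed

text \<open>
  Here \<open>U\<^sub>n = (a)\<^sub>n (b)\<^sub>n / (n! (1-x)\<^sub>n)\<close> is characterised by its recurrence. Multiplying the recurrence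
  of the alternating sums by \<open>U\<^bsub>m+1\<^esub>\<close> shows that the right-hand side grows by exactly \<open>U\<^bsub>m+1\<^esub>\<close>.
\<close>

lemma partial_sum_eq_alternating_sum:
  fixes a b x :: "'a::comm_ring_1" and C U :: "nat \<Rightarrow> 'a"
  assumes ab: "a + b = 1"
    and C0: "a * b * C 0 = 1"
    and CSuc: "\<And>j. (of_nat (Suc j) + a) * (of_nat (Suc j) + b) * C (Suc j)
                    = of_nat (Suc j) * (of_nat (Suc j) + x) * C j"
    and U0: "U 0 = 1"
    and USuc: "\<And>n. of_nat (Suc n) * (of_nat (Suc n) - x) * U (Suc n)
                    = (of_nat n + a) * (of_nat n + b) * U n"
  shows "(\<Sum>n\<le>m. U n)
         = (of_nat m + a) * (of_nat m + b) * U m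
             * (\<Sum>j\<le>m. (-1) ^ j * of_nat (m choose j) * C j)"
proof (induction m)
  case 0
  show ?case
    using C0 U0 by simp
next
  case (Suc m)
  let ?T = "\<lambda>m. \<Sum>j\<le>m. (-1) ^ j * of_nat (m choose j) * C j"
  have "(of_nat (Suc m) + a) * (of_nat (Suc m) + b) * U (Suc m) * ?T (Suc m)
        = U (Suc m) * ((of_nat (Suc m) + a) * (of_nat (Suc m) + b) * ?T (Suc m))"
    by (simp only: mult_ac)
  also have "\<dots> = U (Suc m) * (1 + of_nat (Suc m) * (of_nat (Suc m) - x) * ?T m)"
    by (simp only: alternating_sum_recurrence[OF ab C0 CSuc])
  also have "\<dots> = U (Suc m) + of_nat (Suc m) * (of_nat (Suc m) - x) * U (Suc m) * ?T m"
    by (simp only: distrib_left mult_1_left mult_1_right mult_ac)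
  also have "\<dots> = U (Suc m) + (\<Sum>n\<le>m. U n)"
    by (simp only: USuc Suc.IH)
  finally show ?case
    by simp
qed

section \<open>Generating functions of the harmonic weights\<close>

text \<open>The power series \<open>n! / (1-x)\<^sub>n\<close>.\<close>

definition complete_harm_fps :: "nat \<Rightarrow> real fps" where
  "complete_harm_fps n = (\<Prod>k=1..n. inverse (1 - fps_const (1 / real k) * fps_X))"

text \<open>The polynomial \<open>(1+x)\<^sub>n / n!\<close>.\<close>

definition elementary_harm_fps :: "nat \<Rightarrow> real fps" where
  "elementary_harm_fps n = (\<Prod>k=1..n. 1 + fps_const (1 / real k) * fps_X)"

lemma complete_harm_fps_Suc:
  "(1 - fps_const (1 / real (Suc n)) * fps_X) * complete_harm_fps (Suc n) = complete_harm_fps n"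
proof -
  let ?p = "1 - fps_const (1 / real (Suc n)) * fps_X :: real fps"
  have "inverse ?p * ?p = 1"
    by (rule inverse_mult_eq_1) simp
  moreover have "?p * complete_harm_fps (Suc n) = inverse ?p * ?p * complete_harm_fps n"
    by (simp add: complete_harm_fps_def prod.nat_ivl_Suc' mult_ac)
  ultimately show ?thesis
    by simp
qed

lemma elementary_harm_fps_Suc:
  "elementary_harm_fps (Suc n)
   = (1 + fps_const (1 / real (Suc n)) * fps_X) * elementary_harm_fps n"
  by (simp add: elementary_harm_fps_def mult.commute)

lemma gen_harm_Suc: "gen_harm s (Suc n) = gen_harm s n + 1 / real (Suc n) ^ s"
  by (simp add: gen_harm_def)

lemma complete_harm_fps_nth:
  "complete_harm_fps n $ 0 = 1"
  "complete_harm_fps n $ 1 = harm n"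
  "complete_harm_fps n $ 2 = ((harm n)\<^sup>2 + gen_harm 2 n) / 2"
proof -
  have rec: "complete_harm_fps (Suc n)
             = complete_harm_fps n + fps_const (1 / real (Suc n)) * (fps_X * complete_harm_fps (Suc n))"
    for n
    using complete_harm_fps_Suc[of n] by (simp add: algebra_simps)
  have nth0: "complete_harm_fps (Suc n) $ 0 = complete_harm_fps n $ 0" for n
    by (subst rec) simp
  have nth1: "complete_harm_fps (Suc n) $ 1
              = complete_harm_fps n $ 1 + 1 / real (Suc n) * complete_harm_fps (Suc n) $ 0" for n
    by (subst rec) simp
  have nth2: "complete_harm_fps (Suc n) $ 2
              = complete_harm_fps n $ 2 + 1 / real (Suc n) * complete_harm_fps (Suc n) $ 1" for n
    by (subst rec) simp
  have c0: "complete_harm_fps n $ 0 = 1" for n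
    by (induction n) (simp_all only: nth0, simp add: complete_harm_fps_def)
  have c1: "complete_harm_fps n $ 1 = harm n" for n
  proof (induction n)
    case 0
    show ?case by (simp add: complete_harm_fps_def harm_def)
  next
    case (Suc n)
    show ?case
      unfolding nth1 Suc c0 by (simp add: harm_Suc inverse_eq_divide)
  qed
  have c2: "complete_harm_fps n $ 2 = ((harm n)\<^sup>2 + gen_harm 2 n) / 2" for n
  proof (induction n)
    case 0
    show ?case by (simp add: complete_harm_fps_def harm_def gen_harm_def)
  next
    case (Suc n)
    define r where "r = 1 / real (Suc n)"
    have "1 / real (Suc n) ^ 2 = r\<^sup>2" "inverse (of_nat (Suc n)) = r"
      by (simp_all add: r_def power_divide inverse_eq_divide)
    thus ?case
      unfolding nth2 Suc c1 gen_harm_Suc harm_Suc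
      by (simp only: r_def[symmetric]) (simp add: power2_eq_square field_simps)
  qed
  show "complete_harm_fps n $ 0 = 1"
    "complete_harm_fps n $ 1 = harm n"
    "complete_harm_fps n $ 2 = ((harm n)\<^sup>2 + gen_harm 2 n) / 2"
    by (fact c0, fact c1, fact c2)
qed

lemma elementary_harm_fps_nth:
  "elementary_harm_fps n $ 0 = 1"
  "elementary_harm_fps n $ 1 = harm n"
  "elementary_harm_fps n $ 2 = ((harm n)\<^sup>2 - gen_harm 2 n) / 2"
proof -
  have rec: "elementary_harm_fps (Suc n)
             = elementary_harm_fps n + fps_const (1 / real (Suc n)) * (fps_X * elementary_harm_fps n)"
    for n
    by (simp add: elementary_harm_fps_Suc algebra_simps)
  have c0: "elementary_harm_fps n $ 0 = 1" for n
  proof (induction n)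
    case 0
    show ?case by (simp add: elementary_harm_fps_def)
  next
    case (Suc n)
    thus ?case by (simp add: rec)
  qed
  have c1: "elementary_harm_fps n $ 1 = harm n" for n
  proof (induction n)
    case 0
    show ?case by (simp add: elementary_harm_fps_def harm_def)
  next
    case (Suc n)
    thus ?case
      by (simp add: rec c0 harm_Suc inverse_eq_divide)
  qed
  have c2: "elementary_harm_fps n $ 2 = ((harm n)\<^sup>2 - gen_harm 2 n) / 2" for n
  proof (induction n)
    case 0
    show ?case by (simp add: elementary_harm_fps_def harm_def gen_harm_def)
  next
    case (Suc n)
    define r where "r = 1 / real (Suc n)"
    have r: "1 / real (Suc n) ^ 2 = r\<^sup>2" "inverse (of_nat (Suc n)) = r"
      by (simp_all add: r_def power_divide inverse_eq_divide)
    have "elementary_harm_fps (Suc n) $ 2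
          = elementary_harm_fps n $ 2 + r * elementary_harm_fps n $ 1"
      unfolding rec r_def by simp
    thus ?case
      unfolding Suc c1 gen_harm_Suc harm_Suc r
      by (simp add: power2_eq_square field_simps)
  qed
  show "elementary_harm_fps n $ 0 = 1"
    "elementary_harm_fps n $ 1 = harm n"
    "elementary_harm_fps n $ 2 = ((harm n)\<^sup>2 - gen_harm 2 n) / 2"
    by (fact c0, fact c1, fact c2)
qed

lemma complete_elementary_harm_fps_nth:
  "(complete_harm_fps m * elementary_harm_fps j) $ 0 = 1"
  "(complete_harm_fps m * elementary_harm_fps j) $ 1 = harm m + harm j"
  "(complete_harm_fps m * elementary_harm_fps j) $ 2
   = ((harm m + harm j)\<^sup>2 + gen_harm 2 m - gen_harm 2 j) / 2"
proof -
  have "{0..2::nat} = {0, 1, 2}" "{0..1::nat} = {0, 1}"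
    by auto
  thus "(complete_harm_fps m * elementary_harm_fps j) $ 0 = 1"
    "(complete_harm_fps m * elementary_harm_fps j) $ 1 = harm m + harm j"
    "(complete_harm_fps m * elementary_harm_fps j) $ 2
     = ((harm m + harm j)\<^sup>2 + gen_harm 2 m - gen_harm 2 j) / 2"
    using complete_harm_fps_nth[of m] elementary_harm_fps_nth[of j]
    by (simp_all add: fps_mult_nth power2_eq_square field_simps)
qed

section \<open>The identity as one of power series\<close>

text \<open>
  The parametric identity with \<open>U\<^sub>n = t\<^sub>n n!/(1-x)\<^sub>n\<close> and
  \<open>C\<^sub>j = (1+x)\<^sub>j / (j! (j+a) (j+b) t\<^sub>j)\<close>. The sequence \<open>t\<close> is \<open>(a)\<^sub>n (b)\<^sub>n / n!\<^sup>2\<close>, given by its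
  recurrence; the condition \<open>t j \<noteq> 0\<close> excludes non-positive integers \<open>a\<close> and \<open>b\<close>.
\<close>

lemma hypergeometric_partial_sum_fps:
  fixes a b :: real and t :: "nat \<Rightarrow> real"
  assumes ab: "a + b = 1"
    and t0: "t 0 = 1"
    and tSuc: "\<And>n. (real (Suc n))\<^sup>2 * t (Suc n) = (real n + a) * (real n + b) * t n"
    and t_nz: "\<And>n. t n \<noteq> 0"
  shows "(\<Sum>n\<le>m. fps_const (t n) * complete_harm_fps n)
         = (\<Sum>j\<le>m. fps_const ((real m + a) * (real m + b) * t m * ((-1) ^ j * real (m choose j)
               / ((real j + a) * (real j + b) * t j)))
             * (complete_harm_fps m * elementary_harm_fps j))"
proof -
  define c where "c j = 1 / ((real j + a) * (real j + b) * t j)" for j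
  define C where "C j = fps_const (c j) * elementary_harm_fps j" for j
  define U where "U n = fps_const (t n) * complete_harm_fps n" for n
  have nz: "(real n + a) * (real n + b) \<noteq> 0" for n
    using tSuc[of n] t_nz[of "Suc n"] by (metis mult_eq_0_iff of_nat_neq_0 power_eq_0_iff)
  have ab': "fps_const a + fps_const b = 1"
    by (simp add: ab)
  have C0: "fps_const a * fps_const b * C 0 = 1"
    using nz[of 0] by (simp add: C_def c_def t0 elementary_harm_fps_def)
  have cSuc: "(real (Suc j) + a) * (real (Suc j) + b) * c (Suc j) = (real (Suc j))\<^sup>2 * c j" for j
  proof -
    have "(real (Suc j) + a) * (real (Suc j) + b) * c (Suc j) = 1 / t (Suc j)"
      using nz[of "Suc j"] by (simp add: c_def)
    moreover have "(real (Suc j))\<^sup>2 * c j = (real (Suc j))\<^sup>2 / ((real (Suc j))\<^sup>2 * t (Suc j))"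
      by (simp only: c_def tSuc) simp
    ultimately show ?thesis
      by simp
  qed
  \<comment> \<open>The series \<open>k \<plusminus> x\<close> of the recurrences, written as \<open>k\<close> times the factors of the products.\<close>
  have lin: "of_nat (Suc k) + fps_X
             = fps_const (real (Suc k)) * (1 + fps_const (1 / real (Suc k)) * fps_X)"
    "of_nat (Suc k) - fps_X
     = fps_const (real (Suc k)) * (1 - fps_const (1 / real (Suc k)) * fps_X)" for k
  proof -
    have "fps_const (real (Suc k)) * (fps_const (1 / real (Suc k)) * fps_X) = fps_X"
      by (simp only: mult.assoc[symmetric] fps_const_mult) simp
    thus "of_nat (Suc k) + fps_X
          = fps_const (real (Suc k)) * (1 + fps_const (1 / real (Suc k)) * fps_X)"
      "of_nat (Suc k) - fps_X
       = fps_const (real (Suc k)) * (1 - fps_const (1 / real (Suc k)) * fps_X)"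
      by (simp_all only: distrib_left right_diff_distrib mult_1_right fps_of_nat)
  qed
  have shift: "of_nat k + fps_const r = fps_const (real k + r)" for k and r :: real
    by (simp only: fps_of_nat[symmetric] fps_const_add)
  have CSuc: "(of_nat (Suc j) + fps_const a) * (of_nat (Suc j) + fps_const b) * C (Suc j)
              = of_nat (Suc j) * (of_nat (Suc j) + fps_X) * C j" for j
  proof -
    have "(of_nat (Suc j) + fps_const a) * (of_nat (Suc j) + fps_const b) * C (Suc j)
          = fps_const ((real (Suc j) + a) * (real (Suc j) + b) * c (Suc j))
            * elementary_harm_fps (Suc j)"
      by (simp only: shift C_def fps_const_mult[symmetric] mult_ac)
    also have "\<dots> = of_nat (Suc j) * (of_nat (Suc j) + fps_X) * C j"
      unfolding cSuc lin
      unfolding elementary_harm_fps_Suc C_def power2_eq_square fps_const_mult[symmetric]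
        fps_of_nat[symmetric]
      by (simp only: mult_ac)
    finally show ?thesis .
  qed
  have USuc: "of_nat (Suc n) * (of_nat (Suc n) - fps_X) * U (Suc n)
              = (of_nat n + fps_const a) * (of_nat n + fps_const b) * U n" for n
  proof -
    have "of_nat (Suc n) * (of_nat (Suc n) - fps_X) * U (Suc n)
          = fps_const ((real (Suc n))\<^sup>2 * t (Suc n))
            * ((1 - fps_const (1 / real (Suc n)) * fps_X) * complete_harm_fps (Suc n))"
      unfolding lin
      unfolding U_def power2_eq_square fps_const_mult[symmetric] fps_of_nat[symmetric]
      by (simp only: mult_ac)
    also have "\<dots> = (of_nat n + fps_const a) * (of_nat n + fps_const b) * U n"
      unfolding complete_harm_fps_Suc tSuc
      by (simp only: shift U_def fps_const_mult[symmetric] mult_ac)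
    finally show ?thesis .
  qed
  have U0: "U 0 = 1"
    by (simp add: U_def t0 complete_harm_fps_def)
  have sign: "(-1) ^ j * of_nat k = fps_const ((-1) ^ j * real k)" for j k
    by (simp only: fps_const_mult[symmetric] fps_const_power[symmetric] fps_of_nat
        fps_const_neg[symmetric] fps_const_1_eq_1)
  have "(\<Sum>n\<le>m. U n)
        = fps_const ((real m + a) * (real m + b)) * U m
            * (\<Sum>j\<le>m. fps_const ((-1) ^ j * real (m choose j)) * C j)"
    using partial_sum_eq_alternating_sum[where U = U, OF ab' C0 CSuc U0 USuc, of m]
    by (simp only: shift fps_const_mult sign)
  also have "\<dots> = (\<Sum>j\<le>m. fps_const ((real m + a) * (real m + b) * t m
                     * ((-1) ^ j * real (m choose j) * c j))
                   * (complete_harm_fps m * elementary_harm_fps j))"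
    unfolding sum_distrib_left U_def C_def fps_const_mult[symmetric] by (simp only: mult_ac)
  finally show ?thesis
    by (simp add: U_def c_def)
qed

section \<open>The binomial coefficients\<close>

lemma central_binomial_product:
  "real ((2 * n) choose n) * real ((4 * n) choose (2 * n)) = fact (4 * n) / (fact (2 * n) * (fact n)\<^sup>2)"
proof -
  have "real ((2 * n) choose n) = fact (2 * n) / (fact n * fact n)"
    using binomial_fact[of n "2 * n", where ?'a = real] by simp
  moreover have "real ((4 * n) choose (2 * n)) = fact (4 * n) / (fact (2 * n) * fact (2 * n))"
    using binomial_fact[of "2 * n" "4 * n", where ?'a = real] by simp
  ultimately show ?thesis
    by (simp add: power2_eq_square)
qed

lemma central_binomial_product_Suc:
  fixes t :: "nat \<Rightarrow> real"
  defines "t \<equiv> \<lambda>n. real ((2 * n) choose n) * real ((4 * n) choose (2 * n)) / 64 ^ n"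
  shows "(real (Suc n))\<^sup>2 * t (Suc n) = (real n + 1 / 4) * (real n + 3 / 4) * t n"
proof -
  define N p q u v where "N = real n" and "p = N + 1" and "q = 2 * N + 1"
    and "u = N + 1 / 4" and "v = N + 3 / 4"
  have idx: "4 * Suc n = Suc (Suc (Suc (Suc (4 * n))))" "2 * Suc n = Suc (Suc (2 * n))"
    by simp_all
  have f4: "fact (4 * Suc n) = (4 * p) * (4 * v) * (2 * q) * (4 * u) * fact (4 * n)"
    unfolding idx fact_Suc by (simp add: N_def p_def q_def u_def v_def algebra_simps)
  have f2: "fact (2 * Suc n) = (2 * p) * q * fact (2 * n)"
    unfolding idx fact_Suc by (simp add: N_def p_def q_def u_def v_def algebra_simps)
  have f1: "fact (Suc n) = p * fact n" "real (Suc n) = p"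
    by (simp_all add: N_def p_def algebra_simps)
  have nz: "p \<noteq> 0" "q \<noteq> 0"
    by (simp_all add: N_def p_def q_def add_nonneg_eq_0_iff)
  show ?thesis
    unfolding t_def central_binomial_product f4 f2 f1 N_def[symmetric] u_def[symmetric] v_def[symmetric]
    using nz by (simp add: power_mult_distrib power2_eq_square mult_ac)
qed

theorem corollary6p5:
  fixes m :: nat
  shows
    "(\<Sum>n=0..m. real ((2*n) choose n) * real ((4*n) choose (2*n)) / 64 ^ n)
     = (4 * real m + 1) * (4 * real m + 3) / 64 ^ m
       * real ((2*m) choose m) * real ((4*m) choose (2*m))
       * (\<Sum>j=0..m. (-1) ^ j * real (m choose j)
            * (64 ^ j
               / ((4 * real j + 1) * (4 * real j + 3)
                  * real ((2*j) choose j) * real ((4*j) choose (2*j)))))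
     \<and>
     (\<Sum>n=0..m. real ((2*n) choose n) * real ((4*n) choose (2*n)) / 64 ^ n * harm n)
     = (4 * real m + 1) * (4 * real m + 3) / 64 ^ m
       * real ((2*m) choose m) * real ((4*m) choose (2*m))
       * (\<Sum>j=0..m. (-1) ^ j * real (m choose j)
            * (64 ^ j * (harm m + harm j)
               / ((4 * real j + 1) * (4 * real j + 3)
                  * real ((2*j) choose j) * real ((4*j) choose (2*j)))))
     \<and>
     (\<Sum>n=0..m. real ((2*n) choose n) * real ((4*n) choose (2*n)) / 64 ^ n
          * ((harm n)\<^sup>2 + gen_harm 2 n))
     = (4 * real m + 1) * (4 * real m + 3) / 64 ^ m
       * real ((2*m) choose m) * real ((4*m) choose (2*m))
       * (\<Sum>j=0..m. (-1) ^ j * real (m choose j)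
            * (64 ^ j * ((harm m + harm j)\<^sup>2 + gen_harm 2 m - gen_harm 2 j)
               / ((4 * real j + 1) * (4 * real j + 3)
                  * real ((2*j) choose j) * real ((4*j) choose (2*j)))))"
proof -
  define t where "t n = real ((2*n) choose n) * real ((4*n) choose (2*n)) / 64 ^ n" for n
  define P where "P j = (4 * real j + 1) * (4 * real j + 3) * t j" for j
  have t_nz: "t n \<noteq> 0" for n
    by (simp add: t_def)
  have "(real (Suc n))\<^sup>2 * t (Suc n) = (real n + 1 / 4) * (real n + 3 / 4) * t n" for n
    using central_binomial_product_Suc[of n] by (simp only: t_def)
  hence series: "(\<Sum>n\<le>m. fps_const (t n) * complete_harm_fps n)
      = (\<Sum>j\<le>m. fps_const ((real m + 1 / 4) * (real m + 3 / 4) * t m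
             * ((-1) ^ j * real (m choose j) / ((real j + 1 / 4) * (real j + 3 / 4) * t j)))
           * (complete_harm_fps m * elementary_harm_fps j))"
    by (intro hypergeometric_partial_sum_fps) (use t_nz in \<open>simp_all add: t_def\<close>)
  \<comment> \<open>The factors \<open>16\<close> from \<open>(4k + 1)(4k + 3) = 16 (k + 1/4)(k + 3/4)\<close> at \<open>k = m\<close> and \<open>k = j\<close> cancel.\<close>
  have scale: "(real m + 1 / 4) * (real m + 3 / 4) * t m
        * ((-1) ^ j * real (m choose j) / ((real j + 1 / 4) * (real j + 3 / 4) * t j))
      = P m * ((-1) ^ j * real (m choose j) / P j)" for j
  proof -
    have "P k = 16 * ((real k + 1 / 4) * (real k + 3 / 4) * t k)" for k
      by (simp add: P_def algebra_simps)
    thus ?thesis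
      by (simp add: mult_ac)
  qed
  have coeff: "(\<Sum>n\<le>m. t n * complete_harm_fps n $ i)
      = P m * (\<Sum>j\<le>m. (-1) ^ j * real (m choose j)
                 * ((complete_harm_fps m * elementary_harm_fps j) $ i / P j))" for i
    using arg_cong[OF series, of "\<lambda>f. f $ i"]
    unfolding scale fps_sum_nth fps_mult_left_const_nth by (simp add: sum_distrib_left mult_ac)
  have P_m: "(4 * real m + 1) * (4 * real m + 3) / 64 ^ m
               * real ((2*m) choose m) * real ((4*m) choose (2*m)) = P m"
    by (simp add: P_def t_def)
  have P_j: "64 ^ j / ((4 * real j + 1) * (4 * real j + 3)
               * real ((2*j) choose j) * real ((4*j) choose (2*j))) = 1 / P j"
    "64 ^ j * w / ((4 * real j + 1) * (4 * real j + 3)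
       * real ((2*j) choose j) * real ((4*j) choose (2*j))) = w / P j" for j w
    by (simp_all add: P_def t_def mult_ac)
  note weights = complete_harm_fps_nth complete_elementary_harm_fps_nth
  show ?thesis
    unfolding P_m P_j t_def[symmetric] atLeast0AtMost
  proof (intro conjI)
    show "(\<Sum>n\<le>m. t n) = P m * (\<Sum>j\<le>m. (-1) ^ j * real (m choose j) * (1 / P j))"
      using coeff[of 0] unfolding weights by simp
    show "(\<Sum>n\<le>m. t n * harm n)
          = P m * (\<Sum>j\<le>m. (-1) ^ j * real (m choose j) * ((harm m + harm j) / P j))"
      using coeff[of 1] unfolding weights .
    show "(\<Sum>n\<le>m. t n * ((harm n)\<^sup>2 + gen_harm 2 n))
          = P m * (\<Sum>j\<le>m. (-1) ^ j * real (m choose j)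
              * (((harm m + harm j)\<^sup>2 + gen_harm 2 m - gen_harm 2 j) / P j))"
    proof -
      have half: "t n * (w / 2) = t n * w / 2" "s * (w / 2 / P j) = s * (w / P j) / 2"
        for n j and s w :: real
        by simp_all
      show ?thesis
        using coeff[of 2] unfolding weights half sum_divide_distrib[symmetric] by simp
    qed
  qed
qed

end
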